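(* Let $n\ge 1$ and $\lambda\in[1/(n+1),1/2]$. Let $P\subseteq\mathbb{R}^n$ be a centrally symmetric polytope and assume that $\partial P\subseteq(1-\lambda)P+\lambda V(P)$. Then $P$ is $\lambda$-vertex generated.
   Context: A polytope in $\mathbb{R}^n$ is the convex hull of a finite non-empty set of points; $V(P)$ denotes the set of vertices of $P$; $\partial P$ denotes the boundary of $P$; $A+B=\{a+b: a\in A,b\in B\}$ is the Minkowski sum. A polytope is centrally symmetric if $P=2c-P$ for some $c\in\mathbb{R}^n$. For a polytope $P\subset\mathbb{R}^n$ let $\lambda(P)=\sup\{\lambda\in\mathbb{R}: P=(1-\lambda)P+\lambda V(P)\}$ (value in $(-\infty,+\infty]$; it is $+\infty$ exactly when $P$ is a single point). $P$ is called $\lambda$-vertex generated if $\lambda(P)\ge\lambda$. *)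

theory Defs
  imports "HOL-Analysis.Analysis" "HOL-Library.Set_Algebras"
begin

definition vertices :: "'a::real_vector set \<Rightarrow> 'a set" where
  "vertices P = {v. v extreme_point_of P}"

definition centrally_symmetric :: "'a::real_vector set \<Rightarrow> bool" where
  "centrally_symmetric P \<longleftrightarrow> (\<exists>c. P = (\<lambda>x. 2 *\<^sub>R c - x) ` P)"

text \<open>The set \<open>(1 - l) P + l V(P)\<close>; the sum of sets is the Minkowski sum of
  theory \<open>Set_Algebras\<close>.\<close>

definition vertex_combination :: "real \<Rightarrow> 'a::real_vector set \<Rightarrow> 'a set" where
  "vertex_combination l P = (\<lambda>x. (1 - l) *\<^sub>R x) ` P + (\<lambda>v. l *\<^sub>R v) ` vertices P"

text \<open>The supremum ranges over all real numbers \<open>l\<close>, negative ones included, and is taken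
  in the extended reals because it is infinite when \<open>P\<close> is a single point.\<close>

definition vertex_lambda :: "'a::real_vector set \<Rightarrow> ereal" where
  "vertex_lambda P = Sup {ereal l | l. P = vertex_combination l P}"

definition vertex_generated :: "real \<Rightarrow> 'a::real_vector set \<Rightarrow> bool" where
  "vertex_generated l P \<longleftrightarrow> ereal l \<le> vertex_lambda P"

end

theory Submission
  imports Defs
begin

text \<open>Let \<open>c\<close> be the centre of \<open>P\<close>. The ray from \<open>c\<close> through an interior point \<open>x\<close> meets the
  frontier in a point \<open>y\<close>, so \<open>x = (1 - r) c + r y\<close> with \<open>0 \<le> r \<le> 1\<close>. If
  \<open>y = (1 - l) p + l v\<close>, then \<open>x = (1 - l) q + l v\<close> for the convex combination
  \<open>q = ((1 - r) (1 - 2 l) c + r (1 - l) p + (1 - r) l (2 c - v)) / (1 - l)\<close> of points of \<open>P\<close>.\<close>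

lemma mem_vertex_combination_iff:
  "x \<in> vertex_combination l P \<longleftrightarrow>
    (\<exists>p\<in>P. \<exists>v\<in>vertices P. x = (1 - l) *\<^sub>R p + l *\<^sub>R v)"
  by (auto simp: vertex_combination_def elim!: set_plus_elim)

lemma vertices_subset: "vertices P \<subseteq> P"
  by (auto simp: vertices_def extreme_point_of_def)

lemma vertex_combination_subset:
  assumes "convex P" "0 \<le> l" "l \<le> 1"
  shows "vertex_combination l P \<subseteq> P"
proof
  fix x assume "x \<in> vertex_combination l P"
  then obtain p v where "p \<in> P" "v \<in> P" "x = (1 - l) *\<^sub>R p + l *\<^sub>R v"
    using vertices_subset by (auto simp: mem_vertex_combination_iff)
  then show "x \<in> P"
    using convexD[OF assms(1), of p v "1 - l" l] assms(2,3) by simp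
qed

text \<open>Contracting towards \<open>c\<close> can keep the same vertex \<open>v\<close>: the
  surplus weight \<open>(1 - r) * l\<close> of \<open>v\<close> is offset by its reflection
  \<open>2 *\<^sub>R c - v\<close>, at the expense of the weight of \<open>c\<close>.\<close>

lemma vertex_combination_contract_to_centre:
  assumes "convex P" and sym: "\<And>z. z \<in> P \<Longrightarrow> 2 *\<^sub>R c - z \<in> P"
    and l: "0 \<le> l" "l \<le> 1 / 2" and r: "0 \<le> r" "r \<le> 1"
    and y: "y \<in> vertex_combination l P"
  shows "(1 - r) *\<^sub>R c + r *\<^sub>R y \<in> vertex_combination l P"
proof -
  obtain p v where pv: "p \<in> P" "v \<in> vertices P" "y = (1 - l) *\<^sub>R p + l *\<^sub>R v"
    using y by (auto simp: mem_vertex_combination_iff)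
  have v: "v \<in> P"
    using pv(2) vertices_subset by blast
  \<comment> \<open>The centre is the midpoint of \<open>v\<close> and its reflection.\<close>
  have c: "c \<in> P"
    using convexD[OF assms(1) v sym[OF v], of "1/2" "1/2"]
    by (simp flip: scaleR_add_right)
  \<comment> \<open>Weights of \<open>c\<close>, \<open>p\<close> and the reflected vertex in
    \<open>q\<close>. The bound \<open>l \<le> 1 / 2\<close> makes \<open>a\<close> nonnegative and
    keeps \<open>1 - l\<close> positive.\<close>
  define a b d where abd: "a = (1 - r) * (1 - 2 * l) / (1 - l)" "b = r"
    "d = (1 - r) * l / (1 - l)"
  have scaled: "(1 - l) * a = (1 - r) * (1 - 2 * l)" "(1 - l) * d = (1 - r) * l"
    using l by (simp_all add: abd)
  have "(1 - l) * (a + b + d) = (1 - l) * 1"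
    unfolding distrib_left scaled abd(2) by (simp add: algebra_simps)
  then have sum: "a + b + d = 1"
    using l by simp
  have nonneg: "0 \<le> a" "0 \<le> b" "0 \<le> d"
    using l r by (auto simp: abd)
  define q where "q = a *\<^sub>R c + b *\<^sub>R p + d *\<^sub>R (2 *\<^sub>R c - v)"
  \<comment> \<open>The three-point combination is written as an indexed sum to fit
    \<open>convex_sum\<close>.\<close>
  have "(\<Sum>i\<in>{0, 1, 2::nat}. [a, b, d] ! i *\<^sub>R [c, p, 2 *\<^sub>R c - v] ! i) \<in> P"
    using nonneg sum c pv(1) sym[OF v] by (intro convex_sum assms(1)) auto
  then have q: "q \<in> P"
    by (simp add: q_def add.assoc)
  have "(1 - l) *\<^sub>R q = ((1 - r) * (1 - 2 * l)) *\<^sub>R c + ((1 - l) * r) *\<^sub>R p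
      + ((1 - r) * l) *\<^sub>R (2 *\<^sub>R c - v)"
    by (simp add: q_def scaleR_add_right abd(2) scaled)
  moreover have "(1 - r) *\<^sub>R c + r *\<^sub>R y = ((1 - r) * (1 - 2 * l)) *\<^sub>R c
      + ((1 - l) * r) *\<^sub>R p + ((1 - r) * l) *\<^sub>R (2 *\<^sub>R c - v) + l *\<^sub>R v"
    by (simp add: pv(3) algebra_simps)
  ultimately have "(1 - r) *\<^sub>R c + r *\<^sub>R y = (1 - l) *\<^sub>R q + l *\<^sub>R v"
    by simp
  then show ?thesis
    using q pv(2) by (auto simp: mem_vertex_combination_iff)
qed

lemma vertex_combination_eq_of_frontier_subset:
  fixes P :: "'a::euclidean_space set"
  assumes "convex P" "bounded P" and sym: "\<And>z. z \<in> P \<Longrightarrow> 2 *\<^sub>R c - z \<in> P"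
    and l: "0 \<le> l" "l \<le> 1 / 2"
    and sub: "frontier P \<subseteq> vertex_combination l P"
  shows "P = vertex_combination l P"
proof
  show "vertex_combination l P \<subseteq> P"
    using vertex_combination_subset[of P l] assms(1) l by simp
  show "P \<subseteq> vertex_combination l P"
  proof
    fix x assume "x \<in> P"
    show "x \<in> vertex_combination l P"
    proof (cases "x \<in> interior P")
      case False
      then show ?thesis
        using \<open>x \<in> P\<close> sub closure_subset by (auto simp: frontier_def)
    next
      case True
      \<comment> \<open>At \<open>x = c\<close> no direction is distinguished, so any nonzero vector
        serves for the ray.\<close>
      obtain u :: 'a where "u \<noteq> 0" and u: "x \<noteq> c \<Longrightarrow> u = x - c"
        using nonzero_Basis nonempty_Basis by (metis ex_in_conv right_minus_eq)
      obtain d where d: "d > 0" "x + d *\<^sub>R u \<in> frontier P"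
        using ray_to_frontier[OF assms(2) True \<open>u \<noteq> 0\<close>] by blast
      \<comment> \<open>The exit point is \<open>c + (1 + d) *\<^sub>R (x - c)\<close>, so the
        factor \<open>1 / (1 + d)\<close> brings it back to \<open>x\<close>. For
        \<open>x = c\<close> the factor 0 sends every frontier point to the centre.\<close>
      define r where "r = (if x = c then 0 else 1 / (1 + d))"
      have r: "0 \<le> r" "r \<le> 1"
        using d(1) by (auto simp: r_def)
      have "x = (1 - r) *\<^sub>R c + r *\<^sub>R (x + d *\<^sub>R u)"
      proof (cases "x = c")
        case False
        have "(1 - r) *\<^sub>R c + r *\<^sub>R (x + d *\<^sub>R u) = c + (r * (1 + d)) *\<^sub>R (x - c)"
          by (simp add: u[OF False] algebra_simps)
        also have "r * (1 + d) = 1"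
          using False d(1) by (simp add: r_def)
        finally show ?thesis
          by simp
      qed (simp add: r_def)
      then show ?thesis
        using vertex_combination_contract_to_centre[OF assms(1) sym l r] d(2) sub
        by (metis subsetD)
    qed
  qed
qed

theorem lemma5p1:
  fixes P :: "(real ^ 'n) set" and l :: real
  assumes "1 / (real CARD('n) + 1) \<le> l" and "l \<le> 1 / 2"
    and "polytope P" and "P \<noteq> {}"
    and "centrally_symmetric P"
    and "frontier P \<subseteq> vertex_combination l P"
  shows "vertex_generated l P"
proof -
  obtain c where "P = (\<lambda>x. 2 *\<^sub>R c - x) ` P"
    using assms(5) by (auto simp: centrally_symmetric_def)
  then have "\<And>z. z \<in> P \<Longrightarrow> 2 *\<^sub>R c - z \<in> P"
    by blast
  \<comment> \<open>The lower bound on \<open>l\<close> is positive, as \<open>l\<close> must be a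
    convex weight.\<close>
  moreover have "0 \<le> l"
    by (rule order_trans[OF _ assms(1)]) simp
  ultimately have "P = vertex_combination l P"
    using vertex_combination_eq_of_frontier_subset assms(2,3,6)
      polytope_imp_convex polytope_imp_bounded by metis
  \<comment> \<open>The equality makes \<open>l\<close> a member of the set whose supremum is
    \<open>vertex_lambda P\<close>.\<close>
  then show ?thesis
    unfolding vertex_generated_def vertex_lambda_def by (intro Sup_upper) blast
qed

end
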